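(* Let $K$ be a field of characteristic $0$, let $X=\{x_1,\dots,x_n\}$, and let $p\ge 1$. Let $B_n\subseteq K\langle X\rangle$ be the algebra of proper polynomials and let $\varphi_p:K\langle X\rangle\to F_n(\mathfrak N_p)=K\langle X\rangle/I_{p+1}$ be the natural surjection. Suppose that, as a $\mathrm{GL}(n)$-module, $$\varphi_p(B_n)\cong\bigoplus_{\lambda}k_\lambda V_\lambda ,$$ where $\lambda=(\lambda_1,\lambda_2,\dots,\lambda_n)$ runs over non-negative integer partitions and $k_\lambda$ are multiplicities. Then every $\lambda$ with $k_\lambda\neq 0$ satisfies $\lambda_1\le p-1$.
   Context: $V$ is the $K$-vector space with basis $X$, and $K\langle X\rangle$ is the free (unital) associative algebra on $X$, identified with the tensor algebra $T(V)$. Left-normed commutators: $[u_1,u_2]=u_1u_2-u_2u_1$ and $[u_1,\dots,u_i]=[[u_1,\dots,u_{i-1}],u_i]$ for $i\ge 3$. For $m\ge 2$, $I_m$ is the two-sided ideal of $K\langle X\rangle$ generated by all commutators $[u_1,\dots,u_m]$ with $u_1,\dots,u_m\in K\langle X\rangle$. For $p\ge1$, $F_n(\mathfrak N_p)=K\langle X\rangle/I_{p+1}$. The algebra of proper polynomials $B_n$ is the (unital) subalgebra of $K\langle X\rangle$ generated by all pure commutators $[x_{i_1},\dots,x_{i_r}]$ with $r\ge 2$ and $x_{i_1},\dots,x_{i_r}\in X$. The group $\mathrm{GL}(n)=\mathrm{GL}(V,K)$ acts on $V$ and, diagonally by algebra automorphisms, on $K\langle X\rangle$; $I_{p+1}$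 and $B_n$ are $\mathrm{GL}(n)$-submodules, so $F_n(\mathfrak N_p)$ and $\varphi_p(B_n)$ are $\mathrm{GL}(n)$-modules. For a partition $\lambda=(\lambda_1\ge\dots\ge\lambda_n\ge0)$ with integer parts, $V_\lambda$ is the irreducible polynomial $\mathrm{GL}(n)$-module corresponding to $\lambda$ (highest weight $\lambda$). *)

theory Defs
  imports
    "HOL-Library.Poly_Mapping"
    "HOL-Analysis.Determinants"
    "HOL-Algebra.Algebraic_Closure_Type"
    "HOL-Algebra.Generated_Rings"
    "HOL-Algebra.QuotRing"
    "HOL-Algebra.Module"
begin

no_notation fps_nth (infixl \<open>$\<close> 75)

section \<open>The free associative algebra\<close>

text \<open>
  \<open>K\<langle>X\<rangle>\<close> is the monoid algebra of the free monoid of words in the letters \<open>X\<close>, with the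
  convolution product that \<^typ>\<open>'a \<Rightarrow>\<^sub>0 'b\<close> carries for a monoid \<^typ>\<open>'a\<close> of exponents.
  The words get a type of their own because that product needs their concatenation to be
  written additively. The letters are the elements of a finite linearly ordered type \<open>'n\<close>,
  so that \<open>n = CARD('n) \<ge> 1\<close> and \<open>x\<^sub>1, \<dots>, x\<^sub>n\<close> is the increasing enumeration of \<open>'n\<close>.
\<close>

datatype 'n word = Word (letters: "'n list")

instantiation word :: (type) monoid_add
begin

definition zero_word :: "'a word" where
  "zero_word = Word []"

definition plus_word :: "'a word \<Rightarrow> 'a word \<Rightarrow> 'a word" where
  "plus_word u v = Word (letters u @ letters v)"

instance
  by standard (simp_all add: zero_word_def plus_word_def)

end

type_synonym ('n, 'k) free_alg = "'n word \<Rightarrow>\<^sub>0 'k"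

definition var :: "'n \<Rightarrow> ('n, 'k::field_char_0) free_alg" where
  "var i = Poly_Mapping.single (Word [i]) 1"

definition scal :: "'k \<Rightarrow> ('n, 'k::field_char_0) free_alg" where
  "scal c = Poly_Mapping.single 0 c"

definition commutator :: "'a::ring \<Rightarrow> 'a \<Rightarrow> 'a" where
  "commutator u v = u * v - v * u"

definition left_normed :: "'a::ring list \<Rightarrow> 'a" where
  "left_normed us = foldl commutator (hd us) (tl us)"

abbreviation free_ring :: "('n, 'k::field_char_0) free_alg ring" where
  "free_ring \<equiv> ring_of_type_algebra"

definition comm_ideal :: "nat \<Rightarrow> ('n, 'k::field_char_0) free_alg set" where
  "comm_ideal m = Idl\<^bsub>free_ring\<^esub> {left_normed us | us. length us = m}"

text \<open>The unital subalgebra generated by a set is the subring generated by it and the scalars.\<close>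

definition proper_polys :: "('n, 'k::field_char_0) free_alg set" where
  "proper_polys = generate_ring free_ring
     (range scal \<union> {left_normed (map var is) | is. length is \<ge> 2})"


section \<open>Modules over the general linear group\<close>

text \<open>
  The fields \<^const>\<open>monoid.mult\<close> and \<^const>\<open>monoid.one\<close>, which module records inherit from
  rings, play no role for modules, and \<open>act g\<close> matters only for invertible \<open>g\<close>.
\<close>

record ('k, 'v, 'n::finite) gl_module = "('k, 'v) module" +
  act :: "'k^'n^'n \<Rightarrow> 'v \<Rightarrow> 'v"

definition is_gl_module :: "('k::field_char_0, 'v, 'n::finite) gl_module \<Rightarrow> bool" where
  "is_gl_module M \<longleftrightarrow>
     Module.module (ring_of_type_algebra :: 'k ring) M \<and>
     (\<forall>g. invertible g \<longrightarrow>
        act M g \<in> carrier M \<rightarrow> carrier M \<and>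
        (\<forall>v\<in>carrier M. \<forall>w\<in>carrier M. act M g (v \<oplus>\<^bsub>M\<^esub> w) = act M g v \<oplus>\<^bsub>M\<^esub> act M g w) \<and>
        (\<forall>c. \<forall>v\<in>carrier M. act M g (c \<odot>\<^bsub>M\<^esub> v) = c \<odot>\<^bsub>M\<^esub> act M g v)) \<and>
     (\<forall>v\<in>carrier M. act M (mat 1) v = v) \<and>
     (\<forall>g h. invertible g \<longrightarrow> invertible h \<longrightarrow>
        (\<forall>v\<in>carrier M. act M (g ** h) v = act M g (act M h v)))"

definition gl_isomorphic ::
    "('k::field_char_0, 'v, 'n::finite) gl_module \<Rightarrow> ('k, 'w, 'n) gl_module \<Rightarrow> bool" where
  "gl_isomorphic M N \<longleftrightarrow>
     (\<exists>\<Phi>. bij_betw \<Phi> (carrier M) (carrier N) \<and>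
        (\<forall>v\<in>carrier M. \<forall>w\<in>carrier M. \<Phi> (v \<oplus>\<^bsub>M\<^esub> w) = \<Phi> v \<oplus>\<^bsub>N\<^esub> \<Phi> w) \<and>
        (\<forall>c. \<forall>v\<in>carrier M. \<Phi> (c \<odot>\<^bsub>M\<^esub> v) = c \<odot>\<^bsub>N\<^esub> \<Phi> v) \<and>
        (\<forall>g. invertible g \<longrightarrow> (\<forall>v\<in>carrier M. \<Phi> (act M g v) = act N g (\<Phi> v))))"

definition gl_direct_sum ::
    "'j set \<Rightarrow> ('j \<Rightarrow> ('k::field_char_0, 'v, 'n::finite) gl_module) \<Rightarrow>
     ('k, 'j \<Rightarrow> 'v, 'n) gl_module" where
  "gl_direct_sum J M =
     \<lparr>carrier = {f \<in> \<Pi>\<^sub>E j\<in>J. carrier (M j). finite {j \<in> J. f j \<noteq> \<zero>\<^bsub>M j\<^esub>}},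
      monoid.mult = undefined,
      one = undefined,
      ring.zero = (\<lambda>j\<in>J. \<zero>\<^bsub>M j\<^esub>),
      add = (\<lambda>f h. \<lambda>j\<in>J. f j \<oplus>\<^bsub>M j\<^esub> h j),
      module.smult = (\<lambda>c f. \<lambda>j\<in>J. c \<odot>\<^bsub>M j\<^esub> f j),
      act = (\<lambda>g f. \<lambda>j\<in>J. act (M j) g (f j))\<rparr>"

definition gl_irreducible :: "('k::field_char_0, 'v, 'n::finite) gl_module \<Rightarrow> bool" where
  "gl_irreducible M \<longleftrightarrow>
     carrier M \<noteq> {\<zero>\<^bsub>M\<^esub>} \<and>
     (\<forall>W. submodule W (ring_of_type_algebra :: 'k ring) M \<and>
          (\<forall>g. invertible g \<longrightarrow> act M g ` W \<subseteq> W) \<longrightarrow>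
          W = {\<zero>\<^bsub>M\<^esub>} \<or> W = carrier M)"

inductive poly_matrix_fun :: "('k::field_char_0^'n^'n::finite \<Rightarrow> 'k) \<Rightarrow> bool" where
  const: "poly_matrix_fun (\<lambda>g. c)"
| entry: "poly_matrix_fun (\<lambda>g. g $ i $ j)"
| plus: "poly_matrix_fun a \<Longrightarrow> poly_matrix_fun b \<Longrightarrow> poly_matrix_fun (\<lambda>g. a g + b g)"
| times: "poly_matrix_fun a \<Longrightarrow> poly_matrix_fun b \<Longrightarrow> poly_matrix_fun (\<lambda>g. a g * b g)"

text \<open>
  A polynomial module is finite-dimensional and its matrix coefficients are polynomials in
  the entries of \<open>g\<close>. That \<open>b\<^sub>0, \<dots>, b\<^sub>d\<^sub>-\<^sub>1\<close> is a basis is expressed by the coordinate map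
  from the (extensional) coefficient families being bijective.
\<close>

definition is_basis ::
    "('k::field_char_0, 'v, 'n::finite) gl_module \<Rightarrow> nat \<Rightarrow> (nat \<Rightarrow> 'v) \<Rightarrow> bool" where
  "is_basis M d b \<longleftrightarrow>
     b \<in> {..<d} \<rightarrow> carrier M \<and>
     bij_betw (\<lambda>x. \<Oplus>\<^bsub>M\<^esub>i\<in>{..<d}. x i \<odot>\<^bsub>M\<^esub> b i) ({..<d} \<rightarrow>\<^sub>E UNIV) (carrier M)"

definition gl_polynomial :: "('k::field_char_0, 'v, 'n::finite) gl_module \<Rightarrow> bool" where
  "gl_polynomial M \<longleftrightarrow>
     (\<exists>d b a. is_basis M d b \<and>
        (\<forall>i<d. \<forall>j<d. poly_matrix_fun (a i j)) \<and>
        (\<forall>g. invertible g \<longrightarrow>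
           (\<forall>j<d. act M g (b j) = (\<Oplus>\<^bsub>M\<^esub>i\<in>{..<d}. a i j g \<odot>\<^bsub>M\<^esub> b i))))"

definition diag_matrix :: "('n \<Rightarrow> 'k::field_char_0) \<Rightarrow> 'k^'n^'n::finite" where
  "diag_matrix t = (\<chi> i j. if i = j then t i else 0)"

definition upper_unitriangular :: "'k::field_char_0^('n::{finite,linorder})^('n::{finite,linorder}) \<Rightarrow> bool" where
  "upper_unitriangular u \<longleftrightarrow> (\<forall>i. u $ i $ i = 1) \<and> (\<forall>i j. j < i \<longrightarrow> u $ i $ j = 0)"

definition highest_weight_vector ::
    "('k::field_char_0, 'v, 'n::{finite,linorder}) gl_module \<Rightarrow> ('n \<Rightarrow> nat) \<Rightarrow> 'v \<Rightarrow> bool" where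
  "highest_weight_vector M lam v \<longleftrightarrow>
     v \<in> carrier M \<and> v \<noteq> \<zero>\<^bsub>M\<^esub> \<and>
     (\<forall>u. upper_unitriangular u \<longrightarrow> act M u v = v) \<and>
     (\<forall>t. (\<forall>i. t i \<noteq> 0) \<longrightarrow> act M (diag_matrix t) v = (\<Prod>i\<in>UNIV. t i ^ lam i) \<odot>\<^bsub>M\<^esub> v)"

text \<open>\<open>M\<close> is (a copy of) the irreducible polynomial module \<open>V\<^sub>\<lambda>\<close>.\<close>

definition is_irreducible_with_highest_weight ::
    "('n::{finite,linorder} \<Rightarrow> nat) \<Rightarrow> ('k::field_char_0, 'v, 'n) gl_module \<Rightarrow> bool" where
  "is_irreducible_with_highest_weight lam M \<longleftrightarrow>
     is_gl_module M \<and> gl_polynomial M \<and> gl_irreducible M \<and>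
     (\<exists>v. highest_weight_vector M lam v)"

definition is_partition :: "('n::{finite,linorder} \<Rightarrow> nat) \<Rightarrow> bool" where
  "is_partition lam \<longleftrightarrow> (\<forall>i j. i \<le> j \<longrightarrow> lam j \<le> lam i)"

definition first_part :: "('n::{finite,linorder} \<Rightarrow> nat) \<Rightarrow> nat" where
  "first_part lam = lam (Min UNIV)"

text \<open>\<open>\<Oplus>\<^sub>\<lambda> k\<^sub>\<lambda> V\<^sub>\<lambda>\<close>, with \<open>\<lambda>\<close> running over all partitions with at most \<open>n\<close> parts.\<close>

definition sum_with_multiplicities ::
    "(('n::{finite,linorder} \<Rightarrow> nat) \<Rightarrow> nat) \<Rightarrow>
     (('n \<Rightarrow> nat) \<Rightarrow> ('k::field_char_0, 'v, 'n) gl_module) \<Rightarrow>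
     ('k, ('n \<Rightarrow> nat) \<times> nat \<Rightarrow> 'v, 'n) gl_module" where
  "sum_with_multiplicities k V =
     gl_direct_sum {(lam, i). is_partition lam \<and> i < k lam} (\<lambda>(lam, i). V lam)"


section \<open>Proper polynomials in the relatively free algebra\<close>

text \<open>
  \<open>g\<close> acts by the algebra endomorphism with \<open>x\<^sub>j \<mapsto> \<Sum>\<^sub>i g\<^sub>i\<^sub>j x\<^sub>i\<close>, i.e. \<open>x\<^sub>j\<close> is the \<open>j\<close>-th
  standard basis vector of \<open>V = K\<^sup>n\<close>.
\<close>

definition free_act ::
    "'k::field_char_0^'n^'n::finite \<Rightarrow> ('n, 'k) free_alg \<Rightarrow> ('n, 'k) free_alg" where
  "free_act g f =
     (\<Sum>w\<in>Poly_Mapping.keys f. scal (Poly_Mapping.lookup f w) *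
        prod_list (map (\<lambda>j. \<Sum>i\<in>UNIV. scal (g $ i $ j) * var i) (letters w)))"

abbreviation rel_free_ring :: "nat \<Rightarrow> ('n, 'k::field_char_0) free_alg set ring" where
  "rel_free_ring p \<equiv> free_ring Quot comm_ideal (p + 1)"

definition nat_surj :: "nat \<Rightarrow> ('n, 'k::field_char_0) free_alg \<Rightarrow> ('n, 'k) free_alg set" where
  "nat_surj p f = comm_ideal (p + 1) +>\<^bsub>free_ring\<^esub> f"

text \<open>
  \<open>F\<^sub>n(\<NN>\<^sub>p)\<close>. A scalar acts as multiplication by its residue class. For invertible \<open>g\<close> the
  image of a coset under \<open>g\<close> is a coset, because \<open>g\<close> maps the ideal onto itself.
\<close>

definition rel_free ::
    "nat \<Rightarrow> ('k::field_char_0, ('n::finite, 'k) free_alg set, 'n) gl_module" where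
  "rel_free p =
     \<lparr>carrier = carrier (rel_free_ring p),
      monoid.mult = monoid.mult (rel_free_ring p),
      one = \<one>\<^bsub>rel_free_ring p\<^esub>,
      ring.zero = \<zero>\<^bsub>rel_free_ring p\<^esub>,
      add = add (rel_free_ring p),
      module.smult = (\<lambda>c A. nat_surj p (scal c) \<otimes>\<^bsub>rel_free_ring p\<^esub> A),
      act = (\<lambda>g A. free_act g ` A)\<rparr>"

definition proper_rel_free ::
    "nat \<Rightarrow> ('k::field_char_0, ('n::finite, 'k) free_alg set, 'n) gl_module" where
  "proper_rel_free p = (rel_free p)\<lparr>carrier := nat_surj p ` proper_polys\<rparr>"

end

theory Submission
  imports Defs
begin

text \<open>
  A highest weight vector of weight \<open>\<lambda>\<close> in \<open>\<phi>\<^sub>p(B\<^sub>n)\<close> is represented by a proper polynomial that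
  has degree \<open>\<lambda>\<^sub>1\<close> in \<open>x = x\<^sub>1\<close> modulo \<open>I\<^sub>p\<^sub>+\<^sub>1\<close>, so it suffices that proper polynomials homogeneous
  of degree \<open>q \<ge> p\<close> in \<open>x\<close> lie in \<open>I\<^sub>p\<^sub>+\<^sub>1\<close>. Let \<open>D = [\<cdot>, x]\<close> and let \<open>M\<^sub>q\<close> be the span of all \<open>x\<^sup>j l\<close> with
  \<open>l\<close> a commutator of length \<open>q + 1\<close>. The identity \<open>[l, x] y = [l, x y] - x [l, y]\<close> shows that
  \<open>D\<close> maps \<open>M\<^sub>q\<close> into the largest right ideal \<open>N\<^sub>q\<^sub>+\<^sub>1\<close> contained in \<open>M\<^sub>q\<^sub>+\<^sub>1\<close>. By the Leibniz rule the
  elements \<open>w\<close> with \<open>N\<^sub>r w \<subseteq> N\<^sub>r\<^sub>+\<^sub>q\<close> for all \<open>r\<close> form a filtration \<open>W\<^sub>q\<close> with \<open>D W\<^sub>q \<subseteq> W\<^sub>q\<^sub>+\<^sub>1\<close>,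
  \<open>W\<^sub>a W\<^sub>b \<subseteq> W\<^sub>a\<^sub>+\<^sub>b\<close> and \<open>W\<^sub>0\<close> everything. Hence proper polynomials of degree \<open>q\<close> in \<open>x\<close> lie in
  \<open>W\<^sub>q \<subseteq> M\<^sub>q \<subseteq> I\<^sub>q\<^sub>+\<^sub>1\<close>.
\<close>

section \<open>Products of commutators with a fixed element\<close>

lemma left_normed_snoc: "us \<noteq> [] \<Longrightarrow> left_normed (us @ [u]) = commutator (left_normed us) u"
  by (cases us) (simp_all add: left_normed_def)

text \<open>Powers of \<open>x\<close> are allowed on the left because rewriting
  \<open>[l, x] y\<close> through commutators with \<open>l\<close> leaves a factor \<open>x\<close>
  in front. This additive group is M_q of the overview; central scalars need no rule, as they can be
  absorbed into the first entry of \<open>us\<close>.\<close>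

inductive_set lie_span :: "'a::ring_1 \<Rightarrow> nat \<Rightarrow> 'a set" for x q where
  base: "length us = Suc q \<Longrightarrow> x ^ j * left_normed us \<in> lie_span x q"
| diff: "a \<in> lie_span x q \<Longrightarrow> b \<in> lie_span x q \<Longrightarrow> a - b \<in> lie_span x q"

lemma lie_span_zero: "0 \<in> lie_span x q"
  using lie_span.diff[OF lie_span.base lie_span.base, of "replicate (Suc q) x" q "replicate (Suc q) x" x 0 0]
  by simp

lemma lie_span_0_eq_UNIV: "lie_span x 0 = UNIV"
  using lie_span.base[of "[_]" 0 x 0] by (auto simp: left_normed_def)

lemma commutator_mult_in_lie_span:
  "v \<in> lie_span x q \<Longrightarrow> commutator v x * y \<in> lie_span x (Suc q)"
proof (induction rule: lie_span.induct)
  case (base us j)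
  then have ne: "us \<noteq> []" by auto
  define l where "l = left_normed us"
  \<comment> \<open>Powers of \<open>x\<close> pass through \<open>commutator _ x\<close>, so this
    is \<open>x ^ j\<close> times the identity
    \<open>[l, x] y = [l, x y] - x [l, y]\<close>.\<close>
  have "commutator (x ^ j * l) x * y = x ^ j * commutator l (x * y) - x ^ Suc j * commutator l y"
    by (simp add: commutator_def algebra_simps power_commutes flip: power_Suc2)
       (simp add: mult.assoc power_commutes flip: power_Suc mult.assoc)
  moreover have "x ^ i * commutator l u \<in> lie_span x (Suc q)" for i u
    using lie_span.base[of "us @ [u]" "Suc q" x i] base ne by (simp add: left_normed_snoc l_def)
  ultimately show ?case
    unfolding l_def by (metis lie_span.diff)
next
  case (diff a b)
  have "commutator (a - b) x * y = commutator a x * y - commutator b x * y"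
    by (simp add: commutator_def algebra_simps)
  with diff show ?case
    by (simp add: lie_span.diff)
qed

section \<open>Right cores and the multiplicative filtration\<close>

definition right_core :: "'a::ring_1 \<Rightarrow> nat \<Rightarrow> 'a set" where
  "right_core x q = {v. \<forall>y. v * y \<in> lie_span x q}"

text \<open>These are N_q (\<open>right_core\<close>) and W_q of the overview. Defining the
  filtration by how it shifts the right cores makes it multiplicative by mere composition; no
  product of two commutators has to be expanded.\<close>

definition multipliers :: "'a::ring_1 \<Rightarrow> nat \<Rightarrow> 'a set" where
  "multipliers x q = {w. \<forall>r. \<forall>v\<in>right_core x r. v * w \<in> right_core x (r + q)}"

lemma right_core_subset: "right_core x q \<subseteq> lie_span x q"
proof
  fix v assume "v \<in> right_core x q"
  then have "v * 1 \<in> lie_span x q" unfolding right_core_def by blast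
  then show "v \<in> lie_span x q" by simp
qed

lemma right_core_diff: "a \<in> right_core x q \<Longrightarrow> b \<in> right_core x q \<Longrightarrow> a - b \<in> right_core x q"
  by (simp add: right_core_def left_diff_distrib lie_span.diff)

text \<open>The arbitrary factor \<open>y\<close> in \<open>commutator_mult_in_lie_span\<close>
  lifts the conclusion from the span to its right core.\<close>

lemma right_core_commutator: "v \<in> right_core x q \<Longrightarrow> commutator v x \<in> right_core x (Suc q)"
  using right_core_subset commutator_mult_in_lie_span unfolding right_core_def by blast

text \<open>Each right core is a right ideal.\<close>

lemma multipliers_0_eq_UNIV: "multipliers x 0 = UNIV"
  by (auto simp: multipliers_def right_core_def mult.assoc)

lemma multipliers_diff: "a \<in> multipliers x q \<Longrightarrow> b \<in> multipliers x q \<Longrightarrow> a - b \<in> multipliers x q"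
  by (simp add: multipliers_def right_diff_distrib right_core_diff)

lemma multipliers_mult: "a \<in> multipliers x q \<Longrightarrow> b \<in> multipliers x r \<Longrightarrow> a * b \<in> multipliers x (q + r)"
  by (simp add: multipliers_def flip: mult.assoc add.assoc)

lemma multipliers_commutator:
  assumes "w \<in> multipliers x q"
  shows "commutator w x \<in> multipliers x (Suc q)"
  unfolding multipliers_def
proof (intro CollectI allI ballI)
  fix r v assume v: "v \<in> right_core x r"
  \<comment> \<open>Leibniz rule for \<open>commutator _ x\<close>, solved for the term with
    \<open>commutator w x\<close>; each remaining term gains one level from its bracket.\<close>
  have "v * commutator w x = commutator (v * w) x - commutator v x * w"
    by (simp add: commutator_def algebra_simps)
  moreover have "commutator (v * w) x \<in> right_core x (r + Suc q)"
    using right_core_commutator[of "v * w" x "r + q"] assms v by (simp add: multipliers_def)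
  moreover have "commutator v x * w \<in> right_core x (Suc r + q)"
    using right_core_commutator[OF v] assms by (simp only: multipliers_def) blast
  ultimately show "v * commutator w x \<in> right_core x (r + Suc q)"
    by (simp add: right_core_diff)
qed

text \<open>Level 0 of the span is the whole ring, so 1 lies in \<open>right_core x 0\<close>, and a
  multiplier can be applied to it.\<close>

lemma multipliers_subset_lie_span: "multipliers x q \<subseteq> lie_span x q"
proof
  fix w assume "w \<in> multipliers x q"
  moreover have "1 \<in> right_core x 0"
    by (simp add: right_core_def lie_span_0_eq_UNIV)
  ultimately have "1 * w \<in> right_core x (0 + q)"
    unfolding multipliers_def by blast
  then show "w \<in> lie_span x q"
    using right_core_subset by auto
qed

text \<open>Bracketing with \<open>y k\<close> raises the level by one; bracketing with another
  letter keeps it, since every element has level 0. The induction starts at length 2 because a lone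
  \<open>y k\<close> counts 1 without being a commutator.\<close>

lemma left_normed_in_multipliers:
  assumes "length is \<ge> 2"
  shows "left_normed (map y is) \<in> multipliers (y k :: 'a::ring_1) (count_list is k)"
  using assms
proof (induction "is" rule: rev_induct)
  case (snoc j js)
  show ?case
  proof (cases "length js \<ge> 2")
    case True
    then have "js \<noteq> []" by auto
    then have eq: "left_normed (map y (js @ [j])) = commutator (left_normed (map y js)) (y j)"
      by (simp add: left_normed_snoc)
    have IH: "left_normed (map y js) \<in> multipliers (y k) (count_list js k)" (is "?l \<in> _")
      using snoc.IH True .
    show ?thesis
    proof (cases "j = k")
      case True
      then show ?thesis
        using multipliers_commutator[OF IH] eq by simp
    next
      case False
      have "?l * y j \<in> multipliers (y k) (count_list js k)" "y j * ?l \<in> multipliers (y k) (count_list js k)"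
        using multipliers_mult[OF IH, of "y j" 0] multipliers_mult[OF _ IH, of "y j" 0]
        by (simp_all add: multipliers_0_eq_UNIV)
      with False show ?thesis
        unfolding eq by (simp add: commutator_def multipliers_diff)
    qed
  next
    case False
    with snoc.prems have "length js = 1" by simp
    then obtain i where js: "js = [i]"
      by (auto simp: length_Suc_conv)
    have eq: "left_normed (map y (js @ [j])) = commutator (y i) (y j)"
      by (simp add: js left_normed_def)
    have D: "commutator u (y k) \<in> multipliers (y k) 1" for u
      using multipliers_commutator[of u "y k" 0] by (simp add: multipliers_0_eq_UNIV)
    have zero: "0 \<in> multipliers (y k) q" for q
      using right_core_diff[of _ "y k"] lie_span_zero by (auto simp: multipliers_def right_core_def)
    \<comment> \<open>If both letters are \<open>k\<close>, level 2 is required but the commutator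
      vanishes; if only the first is, the entries are swapped at the cost of a sign.\<close>
    consider "i = k" "j = k" | "i = k" "j \<noteq> k" | "i \<noteq> k" "j = k" | "i \<noteq> k" "j \<noteq> k"
      by blast
    then show ?thesis
    proof cases
      case 1
      then show ?thesis unfolding eq by (simp add: commutator_def zero)
    next
      case 2
      have "commutator (y i) (y j) = 0 - commutator (y j) (y k)"
        by (simp add: commutator_def 2)
      with 2 show ?thesis
        unfolding eq using multipliers_diff[OF zero D, of "y j"] by (simp add: js)
    next
      case 3
      then show ?thesis unfolding eq using D by (simp add: js)
    next
      case 4
      then show ?thesis unfolding eq by (simp add: js multipliers_0_eq_UNIV)
    qed
  qed
qed simp

section \<open>The ideals generated by commutators\<close>

lemma ring_of_type: "ring (ring_of_type_algebra :: 'a::ring_1 ring)"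
proof -
  have "\<exists>y. y + x = 0 \<and> x + y = 0" for x :: 'a
    by (rule exI[of _ "- x"]) simp
  then show ?thesis
    unfolding ring_of_type_algebra_def
    by unfold_locales (auto simp: algebra_simps Units_def)
qed

lemma ring_of_type_simps [simp]:
  "carrier (ring_of_type_algebra :: 'a::ring_1 ring) = UNIV"
  "a \<oplus>\<^bsub>ring_of_type_algebra\<^esub> b = (a + b :: 'a)"
  "a \<otimes>\<^bsub>ring_of_type_algebra\<^esub> b = (a * b :: 'a)"
  "\<zero>\<^bsub>ring_of_type_algebra\<^esub> = (0 :: 'a)"
  "\<one>\<^bsub>ring_of_type_algebra\<^esub> = (1 :: 'a)"
  by (simp_all add: ring_of_type_algebra_def)

lemma ring_of_type_minus [simp]: "\<ominus>\<^bsub>ring_of_type_algebra\<^esub> a = (- a :: 'a::ring_1)"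
  using abelian_group.minus_equality[OF ring.is_abelian_group[OF ring_of_type], of "- a" a] by simp

lemma comm_ideal_ideal: "ideal (comm_ideal m) free_ring"
  unfolding comm_ideal_def by (rule ring.genideal_ideal[OF ring_of_type]) simp

lemma comm_ideal_zero: "0 \<in> comm_ideal m"
  using additive_subgroup.zero_closed[OF ideal.axioms(1)[OF comm_ideal_ideal]] by simp

lemma comm_ideal_add: "a \<in> comm_ideal m \<Longrightarrow> b \<in> comm_ideal m \<Longrightarrow> a + b \<in> comm_ideal m"
  using additive_subgroup.a_closed[OF ideal.axioms(1)[OF comm_ideal_ideal]] by fastforce

lemma comm_ideal_mult_left: "a \<in> comm_ideal m \<Longrightarrow> b * a \<in> comm_ideal m"
  using ideal.I_l_closed[OF comm_ideal_ideal] by fastforce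

lemma comm_ideal_mult_right: "a \<in> comm_ideal m \<Longrightarrow> a * b \<in> comm_ideal m"
  using ideal.I_r_closed[OF comm_ideal_ideal] by fastforce

lemma comm_ideal_diff: "a \<in> comm_ideal m \<Longrightarrow> b \<in> comm_ideal m \<Longrightarrow> a - b \<in> comm_ideal m"
  using comm_ideal_add[of a m "- 1 * b"] comm_ideal_mult_left[of b m "- 1"] by simp

lemma comm_ideal_sum: "(\<And>i. i \<in> A \<Longrightarrow> f i \<in> comm_ideal m) \<Longrightarrow> sum f A \<in> comm_ideal m"
  by (induction A rule: infinite_finite_induct) (auto intro: comm_ideal_zero comm_ideal_add)

text \<open>An initial segment of length \<open>Suc p\<close> gives a generator, and each further
  bracket stays in the two-sided ideal.\<close>

lemma left_normed_in_comm_ideal: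
  assumes "length us \<ge> Suc p"
  shows "left_normed us \<in> comm_ideal (Suc p)"
  using assms
proof (induction us rule: rev_induct)
  case (snoc u us)
  show ?case
  proof (cases "length (us @ [u]) = Suc p")
    case True
    then show ?thesis
      unfolding comm_ideal_def
      using ring.genideal_self[OF ring_of_type] by (metis (mono_tags, lifting) mem_Collect_eq ring_of_type_simps(1) subsetD subset_UNIV)
  next
    case False
    with snoc.prems have "length us \<ge> Suc p" by simp
    then have "us \<noteq> []" and "left_normed us \<in> comm_ideal (Suc p)"
      using snoc.IH by auto
    then show ?thesis
      by (simp add: left_normed_snoc commutator_def comm_ideal_diff comm_ideal_mult_left comm_ideal_mult_right)
  qed
qed simp

lemma lie_span_subset_comm_ideal:
  assumes "p \<le> q"
  shows "lie_span x q \<subseteq> comm_ideal (Suc p)"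
proof
  fix v assume "v \<in> lie_span x q"
  then show "v \<in> comm_ideal (Suc p)"
  proof induction
    case (base us j)
    with assms show ?case
      by (intro comm_ideal_mult_left left_normed_in_comm_ideal) simp
  qed (rule comm_ideal_diff)
qed

section \<open>The torus action\<close>

abbreviation torus :: "('n::finite \<Rightarrow> 'k::field_char_0) \<Rightarrow> ('n, 'k) free_alg \<Rightarrow> ('n, 'k) free_alg" where
  "torus t \<equiv> free_act (diag_matrix t)"

lemma scal_mult: "scal a * scal b = scal (a * b)"
  by (simp add: scal_def mult_single)

lemma scal_add: "scal (a + b) = scal a + scal b"
  by (simp add: scal_def single_add)

lemma scal_0: "scal 0 = 0"
  by (simp add: scal_def)

lemma scal_sum: "scal (sum f A) = (\<Sum>i\<in>A. scal (f i))"
  by (induction A rule: infinite_finite_induct) (auto simp: scal_add scal_0)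

lemma scal_1: "scal 1 = 1"
  by (simp add: scal_def)

lemma scal_mult_single: "scal c * Poly_Mapping.single w a = Poly_Mapping.single w (c * a)"
  by (simp add: scal_def mult_single)

lemma sum_single_lookup: "(\<Sum>w\<in>Poly_Mapping.keys f. Poly_Mapping.single w (Poly_Mapping.lookup f w)) = f"
  by (rule poly_mapping_eqI)
     (auto simp: lookup_sum lookup_single when_def in_keys_iff sum.delta)

lemma single_mult_scal: "Poly_Mapping.single w a * scal c = Poly_Mapping.single w (c * a)"
  by (simp add: scal_def mult_single mult.commute)

lemma scal_commute: "f * scal c = scal c * (f :: ('n, 'k::field_char_0) free_alg)"
proof -
  have "(\<Sum>w\<in>Poly_Mapping.keys f. Poly_Mapping.single w (Poly_Mapping.lookup f w)) * scal c =
        scal c * (\<Sum>w\<in>Poly_Mapping.keys f. Poly_Mapping.single w (Poly_Mapping.lookup f w))"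
    by (simp add: sum_distrib_left sum_distrib_right single_mult_scal scal_mult_single)
  then show ?thesis by (simp only: sum_single_lookup)
qed

lemma prod_list_scal_var:
  "prod_list (map (\<lambda>j. scal (t j) * var j) js) = Poly_Mapping.single (Word js) (prod_list (map t js))"
proof (induction js)
  case Nil
  then show ?case by (simp add: zero_word_def[symmetric])
next
  case (Cons j js)
  then show ?case by (simp add: var_def scal_mult_single mult_single plus_word_def)
qed

text \<open>A diagonal matrix only rescales the letters, so every word is an eigenvector and the
  torus acts coefficientwise.\<close>

lemma torus_eq:
  "torus t f = (\<Sum>w\<in>Poly_Mapping.keys f.
     Poly_Mapping.single w (Poly_Mapping.lookup f w * prod_list (map t (letters w))))"
proof -
  have "(\<Sum>i\<in>UNIV. scal (diag_matrix t $ i $ j) * var i) = scal (t j) * var j" for j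
  proof -
    have "(\<Sum>i\<in>UNIV. scal (diag_matrix t $ i $ j) * var i)
        = (\<Sum>i\<in>UNIV. if i = j then scal (t i) * var i else 0)"
      by (rule sum.cong) (auto simp: diag_matrix_def scal_0)
    then show ?thesis by simp
  qed
  then show ?thesis
    by (simp add: free_act_def prod_list_scal_var scal_mult_single)
qed

lemma lookup_torus:
  "Poly_Mapping.lookup (torus t f) w = Poly_Mapping.lookup f w * prod_list (map t (letters w))"
  by (auto simp: torus_eq lookup_sum lookup_single when_def in_keys_iff sum.delta)

lemma torus_single: "torus t (Poly_Mapping.single w a) = Poly_Mapping.single w (a * prod_list (map t (letters w)))"
  by (rule poly_mapping_eqI) (auto simp: lookup_torus lookup_single when_def)

lemma torus_add: "torus t (f + g) = torus t f + torus t g"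
  by (rule poly_mapping_eqI) (simp add: lookup_torus lookup_add algebra_simps)

lemma torus_diff: "torus t (f - g) = torus t f - torus t g"
  by (rule poly_mapping_eqI) (simp add: lookup_torus lookup_minus algebra_simps)

lemma torus_0: "torus t 0 = 0"
  by (rule poly_mapping_eqI) (simp add: lookup_torus)

lemma torus_uminus: "torus t (- f) = - torus t f"
  using torus_diff[of t 0 f] by (simp add: torus_0)

lemma torus_sum: "torus t (sum f A) = (\<Sum>i\<in>A. torus t (f i))"
  by (induction A rule: infinite_finite_induct) (auto simp: torus_0 torus_add)

lemma torus_scal: "torus t (scal c) = scal c"
  by (simp add: scal_def torus_single zero_word_def)

lemma torus_var: "torus t (var i) = scal (t i) * var i"
  by (simp add: var_def torus_single scal_mult_single)

text \<open>By bilinearity it suffices to treat single words, where weights multiply under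
  concatenation.\<close>

lemma torus_mult: "torus t (f * g) = torus t f * torus t g"
proof -
  have single: "torus t (Poly_Mapping.single u a * Poly_Mapping.single v b) =
      torus t (Poly_Mapping.single u a) * torus t (Poly_Mapping.single v b)" for u v a b
    by (simp add: mult_single torus_single plus_word_def mult_ac)
  define F where "F = (\<lambda>f::('a,'b) free_alg. \<Sum>w\<in>Poly_Mapping.keys f. Poly_Mapping.single w (Poly_Mapping.lookup f w))"
  have "torus t (F f * F g) = torus t (F f) * torus t (F g)"
    by (simp add: F_def sum_product torus_sum single)
  then show ?thesis by (simp add: F_def sum_single_lookup)
qed

lemma torus_inverse:
  assumes "\<And>i. t i \<noteq> 0"
  shows "torus t (torus (\<lambda>i. inverse (t i)) f) = f"
proof (rule poly_mapping_eqI)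
  fix w
  have "prod_list (map (\<lambda>i. inverse (t i)) js) * prod_list (map t js) = 1" for js
    by (induction js) (simp_all add: assms field_simps)
  then show "Poly_Mapping.lookup (torus t (torus (\<lambda>i. inverse (t i)) f)) w = Poly_Mapping.lookup f w"
    by (simp add: lookup_torus mult.assoc)
qed

lemma torus_commutator: "torus t (commutator u v) = commutator (torus t u) (torus t v)"
  by (simp add: commutator_def torus_diff torus_mult)

lemma torus_left_normed: "us \<noteq> [] \<Longrightarrow> torus t (left_normed us) = left_normed (map (torus t) us)"
proof (induction us rule: rev_induct)
  case (snoc u us)
  show ?case
  proof (cases "us = []")
    case False
    with snoc show ?thesis by (simp add: left_normed_snoc torus_commutator)
  qed (simp add: left_normed_def)
qed simp

lemma torus_left_normed_vars:
  "is \<noteq> [] \<Longrightarrow> torus t (left_normed (map var is)) = scal (prod_list (map t is)) * left_normed (map var is)"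
proof (induction "is" rule: rev_induct)
  case (snoc j js)
  show ?case
  proof (cases "js = []")
    case False
    define l where "l = (left_normed (map var js) :: ('a, 'b) free_alg)"
    define c where "c = prod_list (map t js)"
    have "commutator (scal c * l) (scal (t j) * var j) = scal (c * t j) * commutator l (var j)"
      unfolding commutator_def right_diff_distrib scal_mult[symmetric]
      by (metis (no_types, lifting) mult.assoc scal_commute)
    with False snoc show ?thesis
      by (simp add: left_normed_snoc torus_commutator torus_var l_def c_def)
  qed (simp add: left_normed_def torus_var)
qed simp

text \<open>The preimage of an ideal under a ring endomorphism is an ideal; it contains the
  generators because the endomorphism carries commutators to commutators of the same length.\<close>

lemma torus_comm_ideal:
  assumes "f \<in> comm_ideal (Suc p)"
  shows "torus t f \<in> comm_ideal (Suc p)"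
proof -
  have "ideal {f. torus t f \<in> comm_ideal (Suc p)} free_ring"
  proof (rule idealI[OF ring_of_type])
    show "subgroup {f. torus t f \<in> comm_ideal (Suc p)} (add_monoid free_ring)"
    proof (rule group.subgroupI)
      show "Group.group (add_monoid (free_ring :: ('a, 'b) free_alg ring))"
        using ring_of_type abelian_group.a_group ring.is_abelian_group by blast
      fix a assume "a \<in> {f. torus t f \<in> comm_ideal (Suc p)}"
      then show "inv\<^bsub>add_monoid free_ring\<^esub> a \<in> {f. torus t f \<in> comm_ideal (Suc p)}"
        using comm_ideal_diff[OF comm_ideal_zero, of "torus t a"] ring_of_type_minus[of a]
        by (simp only: a_inv_def mem_Collect_eq torus_uminus diff_0)
    qed (auto simp: torus_add comm_ideal_add intro!: exI[of _ 0] comm_ideal_zero simp: torus_0)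
  qed (auto simp: torus_mult comm_ideal_mult_left comm_ideal_mult_right)
  moreover have "{left_normed us |us. length us = Suc p} \<subseteq> {f. torus t f \<in> comm_ideal (Suc p)}"
  proof safe
    fix us :: "('a, 'b) free_alg list"
    assume "length us = Suc p"
    then show "torus t (left_normed us) \<in> comm_ideal (Suc p)"
      using torus_left_normed[of us t] left_normed_in_comm_ideal[of p "map (torus t) us"] by force
  qed
  ultimately have "comm_ideal (Suc p) \<subseteq> {f. torus t f \<in> comm_ideal (Suc p)}"
    by (subst comm_ideal_def) (rule ring.genideal_minimal[OF ring_of_type])
  with assms show ?thesis by blast
qed

section \<open>Proper polynomials under the torus\<close>

lemma scal_in_proper_polys: "scal c \<in> proper_polys"
  unfolding proper_polys_def by (rule generate_ring.incl) auto

lemma proper_polys_mult: "f \<in> proper_polys \<Longrightarrow> g \<in> proper_polys \<Longrightarrow> f * g \<in> proper_polys"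
  unfolding proper_polys_def using generate_ring.eng_mult by fastforce

lemma torus_proper_polys:
  assumes "f \<in> proper_polys"
  shows "torus t f \<in> proper_polys"
  using assms unfolding proper_polys_def
proof induction
  case one
  then show ?case using torus_scal[of t 1] scal_in_proper_polys[of 1] by (simp add: scal_1 proper_polys_def)
next
  case (incl f)
  then consider c where "f = scal c" | "is" where "f = left_normed (map var is)" "length is \<ge> 2"
    by blast
  then show ?case
  proof cases
    case 1
    then show ?thesis using scal_in_proper_polys by (simp add: torus_scal proper_polys_def)
  next
    case 2
    then have "is \<noteq> []" by auto
    moreover have "f \<in> proper_polys"
      unfolding proper_polys_def by (rule generate_ring.incl) (use 2 in auto)
    ultimately show ?thesis
      using proper_polys_mult[OF scal_in_proper_polys]
      by (simp add: 2(1) torus_left_normed_vars proper_polys_def)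
  qed
next
  case (a_inv h)
  then show ?case using generate_ring.a_inv by (fastforce simp: torus_uminus)
next
  case (eng_add a b)
  then show ?case using generate_ring.eng_add by (fastforce simp: torus_add)
next
  case (eng_mult a b)
  then show ?case using generate_ring.eng_mult by (fastforce simp: torus_mult)
qed

section \<open>Grading by the degree in one letter\<close>

definition line_torus :: "'n::{finite,linorder} \<Rightarrow> 'k::field_char_0 \<Rightarrow> 'n \<Rightarrow> 'k" where
  "line_torus i s = (\<lambda>j. if j = i then s else 1)"

lemma prod_list_line_torus: "prod_list (map (line_torus i s) js) = s ^ count_list js i"
  by (induction js) (simp_all add: line_torus_def)

text \<open>Homogeneity of degree \<open>q\<close> in the letter \<open>i\<close>. Since the field
  is infinite, the eigenvalue condition says that \<open>i\<close> occurs exactly \<open>q\<close>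
  times in every word of \<open>f\<close>.\<close>

definition torus_degree :: "'n::{finite,linorder} \<Rightarrow> nat \<Rightarrow> ('n, 'k::field_char_0) free_alg set" where
  "torus_degree i q = {f. \<forall>s. torus (line_torus i s) f = scal (s ^ q) * f}"

lemma torus_degree_mult:
  assumes "f \<in> torus_degree i q" "g \<in> torus_degree i r"
  shows "f * g \<in> torus_degree i (q + r)"
  unfolding torus_degree_def
proof (intro CollectI allI)
  fix s
  have "scal (s ^ q) * f * (scal (s ^ r) * g) = scal (s ^ q) * (f * scal (s ^ r)) * g"
    by (simp only: mult.assoc)
  also have "\<dots> = scal (s ^ (q + r)) * (f * g)"
    by (simp only: scal_commute[of f] power_add scal_mult[symmetric] mult.assoc)
  finally show "torus (line_torus i s) (f * g) = scal (s ^ (q + r)) * (f * g)"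
    using assms by (simp add: torus_degree_def torus_mult)
qed

text \<open>The same \<open>q\<close> serves as filtration level and as degree in the letter
  \<open>i\<close>. This coupling is what later puts the components of high degree into the
  ideal.\<close>

inductive_set graded_multipliers :: "'n::{finite,linorder} \<Rightarrow> ('n, 'k::field_char_0) free_alg set" for i where
  homogeneous: "w \<in> multipliers (var i) q \<Longrightarrow> w \<in> torus_degree i q \<Longrightarrow> w \<in> graded_multipliers i"
| add: "f \<in> graded_multipliers i \<Longrightarrow> g \<in> graded_multipliers i \<Longrightarrow> f + g \<in> graded_multipliers i"

lemma graded_multipliers_scal: "scal c \<in> graded_multipliers i"
  by (rule graded_multipliers.homogeneous[of _ _ 0])
     (simp_all add: multipliers_0_eq_UNIV torus_degree_def torus_scal scal_1)

lemma graded_multipliers_mult: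
  assumes "f \<in> graded_multipliers i" "g \<in> graded_multipliers i"
  shows "f * g \<in> graded_multipliers i"
  using assms(1)
proof induction
  case (homogeneous w q)
  show ?case
    using assms(2)
  proof induction
    case (homogeneous v r)
    with \<open>w \<in> multipliers (var i) q\<close> \<open>w \<in> torus_degree i q\<close> show ?case
      by (intro graded_multipliers.homogeneous[of _ _ "q + r"] multipliers_mult torus_degree_mult)
  qed (simp add: distrib_left graded_multipliers.add)
qed (simp add: distrib_right graded_multipliers.add)

text \<open>For a pure commutator both the level and the degree are \<open>count_list is i\<close>,
  for a scalar both are 0; sums and products preserve the coupling.\<close>

lemma proper_poly_in_graded_multipliers:
  assumes "f \<in> proper_polys"
  shows "f \<in> graded_multipliers i"
proof -
  show ?thesis
    using assms unfolding proper_polys_def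
  proof induction
    case one
    show ?case using graded_multipliers_scal[of 1 i] by (simp add: scal_1)
  next
    case (incl f)
    then consider c where "f = scal c" | "is" where "f = left_normed (map var is)" "length is \<ge> 2"
      by blast
    then show ?case
    proof cases
      case 1
      then show ?thesis by (simp add: graded_multipliers_scal)
    next
      case 2
      then have "is \<noteq> []" by auto
      then show ?thesis
        unfolding 2(1)
        by (intro graded_multipliers.homogeneous[of _ _ "count_list is i"] left_normed_in_multipliers 2(2))
           (simp add: torus_degree_def torus_left_normed_vars prod_list_line_torus)
    qed
  next
    case (a_inv h)
    have "- h = scal (- 1) * h"
      by (simp add: scal_def single_uminus)
    with a_inv show ?case
      using graded_multipliers_mult[OF graded_multipliers_scal] by simp
  next
    case (eng_add a b)
    then show ?case by (simp add: graded_multipliers.add)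
  next
    case (eng_mult a b)
    then show ?case by (simp add: graded_multipliers_mult)
  qed
qed

text \<open>
  If \<open>h\<close> vanishes at \<open>2\<^sup>q\<close> for \<open>q < p\<close>, then applying \<open>h\<close> to the torus element with \<open>s = 2\<close> kills the
  components of \<open>f\<close> of degree below \<open>p\<close>, while it multiplies the weight vector by \<open>h(2\<^sup>m) \<noteq> 0\<close>.
\<close>

lemma proper_weight_vector_in_comm_ideal:
  fixes f :: "('n::{finite,linorder}, 'k::field_char_0) free_alg"
  assumes f: "f \<in> proper_polys"
    and weight: "\<And>s. s \<noteq> 0 \<Longrightarrow> torus (line_torus i s) f - scal (s ^ m) * f \<in> comm_ideal (Suc p)"
    and "p \<le> m"
  shows "f \<in> comm_ideal (Suc p)"
proof -
  define h :: "'k poly" where "h = (\<Prod>q<p. [:- (2 ^ q), 1:])"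
  \<comment> \<open>With \<open>F k\<close> the k-th power of the torus element for
    \<open>s = 2\<close> applied to a vector, \<open>H F\<close> is the operator polynomial
    \<open>h\<close> applied to that vector. Taking a sequence as argument lets \<open>H\<close> act
    on powers of eigenvalues too.\<close>
  define H where "H = (\<lambda>F :: nat \<Rightarrow> ('n, 'k) free_alg. \<Sum>k\<le>degree h. scal (coeff h k) * F k)"
  have H_power: "H (\<lambda>k. scal ((2 ^ k) ^ q) * g) = scal (poly h (2 ^ q)) * g" for q g
    by (simp add: H_def poly_altdef scal_sum sum_distrib_right scal_mult[symmetric] mult.assoc
                  power_mult[symmetric] mult.commute[of q])
  have "g \<in> graded_multipliers i \<Longrightarrow> H (\<lambda>k. torus (line_torus i (2 ^ k)) g) \<in> comm_ideal (Suc p)" for g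
  proof (induction rule: graded_multipliers.induct)
    case (homogeneous w q)
    have eq: "H (\<lambda>k. torus (line_torus i (2 ^ k)) w) = scal (poly h (2 ^ q)) * w"
      using homogeneous(2) by (simp add: torus_degree_def flip: H_power)
    show ?case
    proof (cases "q < p")
      case True
      then have "poly h (2 ^ q) = 0"
        by (auto simp: h_def poly_prod)
      then show ?thesis
        unfolding eq by (simp add: scal_0 comm_ideal_zero)
    next
      case False
      \<comment> \<open>Components of degree at least \<open>p\<close> need not be annihilated:
        their filtration level already places them in the ideal.\<close>
      then have "w \<in> comm_ideal (Suc p)"
        using homogeneous(1) multipliers_subset_lie_span lie_span_subset_comm_ideal[of p q] by fastforce
      then show ?thesis
        unfolding eq by (rule comm_ideal_mult_left)
    qed
  next
    case (add a b)
    have "H (\<lambda>k. torus (line_torus i (2 ^ k)) (a + b)) =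
        H (\<lambda>k. torus (line_torus i (2 ^ k)) a) + H (\<lambda>k. torus (line_torus i (2 ^ k)) b)"
      by (simp add: H_def torus_add distrib_left sum.distrib)
    with add.IH show ?case by (simp add: comm_ideal_add)
  qed
  then have 1: "H (\<lambda>k. torus (line_torus i (2 ^ k)) f) \<in> comm_ideal (Suc p)"
    using proper_poly_in_graded_multipliers[OF f] by blast
  \<comment> \<open>\<open>f\<close> is an eigenvector only modulo the ideal, so the error terms are
    collected under \<open>H\<close> and subtracted afterwards.\<close>
  have 2: "H (\<lambda>k. torus (line_torus i (2 ^ k)) f - scal ((2 ^ k) ^ m) * f) \<in> comm_ideal (Suc p)"
    unfolding H_def by (intro comm_ideal_sum comm_ideal_mult_left weight) simp
  have "H (\<lambda>k. torus (line_torus i (2 ^ k)) f) - H (\<lambda>k. torus (line_torus i (2 ^ k)) f - scal ((2 ^ k) ^ m) * f)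
      = H (\<lambda>k. scal ((2 ^ k) ^ m) * f)"
    by (simp add: H_def right_diff_distrib sum_subtractf)
  with comm_ideal_diff[OF 1 2] have 3: "scal (poly h (2 ^ m)) * f \<in> comm_ideal (Suc p)"
    by (simp only: H_power)
  \<comment> \<open>In characteristic 0 distinct powers of 2 stay distinct in the field.\<close>
  have "(2 :: 'k) ^ m \<noteq> 2 ^ q" if "q < p" for q
  proof
    assume "(2 :: 'k) ^ m = 2 ^ q"
    then have "(of_nat (2 ^ m) :: 'k) = of_nat (2 ^ q)" by simp
    then have "(2 :: nat) ^ m = 2 ^ q" by (simp only: of_nat_eq_iff)
    with that \<open>p \<le> m\<close> show False by simp
  qed
  then have "poly h (2 ^ m) \<noteq> 0"
    by (simp add: h_def poly_prod)
  then have "scal (inverse (poly h (2 ^ m))) * (scal (poly h (2 ^ m)) * f) = f"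
    by (simp add: scal_mult scal_1 flip: mult.assoc)
  with comm_ideal_mult_left[OF 3, of "scal (inverse (poly h (2 ^ m)))"] show ?thesis
    by simp
qed

section \<open>The general linear group acting on the relatively free algebra\<close>

lemma nat_surj_eq: "nat_surj p f = {g. g - f \<in> comm_ideal (Suc p)}"
proof -
  have "g \<in> (\<lambda>a. a + f) ` comm_ideal (Suc p)" if "g - f \<in> comm_ideal (Suc p)" for g
    using that by (intro image_eqI[of _ _ "g - f"]) auto
  then show ?thesis
    by (auto simp: nat_surj_def a_r_coset_def r_coset_def)
qed

lemma nat_surj_self: "f \<in> nat_surj p f"
  by (simp add: nat_surj_eq comm_ideal_zero)

lemma nat_surj_zero_class:
  assumes "f \<in> comm_ideal (Suc p)"
  shows "nat_surj p f = comm_ideal (Suc p)"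
proof -
  have "g - f \<in> comm_ideal (Suc p) \<longleftrightarrow> g \<in> comm_ideal (Suc p)" for g
    using comm_ideal_add[of "g - f" "Suc p" f] comm_ideal_diff[of g "Suc p" f] assms by auto
  then show ?thesis
    by (simp add: nat_surj_eq)
qed

lemma nat_surj_add: "nat_surj p f \<oplus>\<^bsub>rel_free p\<^esub> nat_surj p g = nat_surj p (f + g)"
proof -
  interpret ideal "comm_ideal (p + 1) :: ('a, 'b) free_alg set" free_ring
    by (rule comm_ideal_ideal)
  show ?thesis
    using a_rcos_sum[of f g] by (simp add: rel_free_def FactRing_def nat_surj_def)
qed

lemma nat_surj_smult: "c \<odot>\<^bsub>rel_free p\<^esub> nat_surj p f = nat_surj p (scal c * f)"
  using ideal.rcoset_mult_add[OF comm_ideal_ideal[of "p + 1"], of "scal c" f]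
  by (simp add: rel_free_def FactRing_def nat_surj_def)

text \<open>The reverse inclusion pulls the difference back by the inverse torus element, which also
  preserves the ideal.\<close>

lemma torus_nat_surj:
  assumes "\<And>i. t i \<noteq> 0"
  shows "torus t ` nat_surj p f = nat_surj p (torus t f)"
proof
  show "torus t ` nat_surj p f \<subseteq> nat_surj p (torus t f)"
    by (auto simp: nat_surj_eq torus_comm_ideal simp flip: torus_diff)
  show "nat_surj p (torus t f) \<subseteq> torus t ` nat_surj p f"
  proof
    fix g assume "g \<in> nat_surj p (torus t f)"
    then have g: "g - torus t f \<in> comm_ideal (Suc p)"
      by (simp add: nat_surj_eq)
    have "g = torus t (torus (\<lambda>i. inverse (t i)) (g - torus t f) + f)"
      by (simp add: torus_add torus_inverse[OF assms])
    with torus_comm_ideal[OF g] show "g \<in> torus t ` nat_surj p f"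
      by (intro image_eqI) (auto simp: nat_surj_eq)
  qed
qed

lemma invertible_diag_matrix:
  assumes "\<And>i. t i \<noteq> (0 :: 'k::field_char_0)"
  shows "invertible (diag_matrix t)"
proof -
  have "diag_matrix s ** diag_matrix u = mat 1" if "\<And>i. s i * u i = 1" for s u :: "'n::finite \<Rightarrow> 'k"
  proof -
    have "(\<Sum>k\<in>UNIV. (if i = k then s i else 0) * (if k = j then u k else 0)) = (if i = j then 1 else 0)" for i j
    proof -
      have "(\<Sum>k\<in>UNIV. (if i = k then s i else 0) * (if k = j then u k else 0))
          = (\<Sum>k\<in>UNIV. if i = k then s k * (if k = j then u k else 0) else 0)"
        by (rule sum.cong) auto
      then show ?thesis by (simp add: that)
    qed
    then show ?thesis
      by (simp add: matrix_matrix_mult_def diag_matrix_def mat_def vec_eq_iff)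
  qed
  from this[of t "\<lambda>i. inverse (t i)"] this[of "\<lambda>i. inverse (t i)" t] show ?thesis
    unfolding invertible_def using assms by auto
qed

section \<open>Eigenvectors in direct sums\<close>

lemma gl_module_act_zero:
  assumes "is_gl_module M" "invertible g"
  shows "act M g \<zero>\<^bsub>M\<^esub> = \<zero>\<^bsub>M\<^esub>"
proof -
  interpret module "ring_of_type_algebra :: 'b ring" M
    using assms by (simp add: is_gl_module_def)
  have "act M g \<zero>\<^bsub>M\<^esub> \<in> carrier M"
    using assms M.zero_closed unfolding is_gl_module_def by (blast dest: funcset_mem)
  moreover have "act M g (\<zero>\<^bsub>M\<^esub> \<oplus>\<^bsub>M\<^esub> \<zero>\<^bsub>M\<^esub>) = act M g \<zero>\<^bsub>M\<^esub> \<oplus>\<^bsub>M\<^esub> act M g \<zero>\<^bsub>M\<^esub>"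
    using assms M.zero_closed unfolding is_gl_module_def by blast
  ultimately show ?thesis
    by (simp add: M.add.r_cancel_one)
qed

text \<open>\<open>e\<close> is \<open>v\<close> extended by zero to the other summands. That it is
  nonzero is recorded as \<open>e + e\<close> differing from \<open>e\<close>, a form that transfers
  along an additive map without mentioning zero elements.\<close>

lemma direct_sum_summand_vector:
  fixes M :: "'j \<Rightarrow> ('k::field_char_0, 'v, 'n::finite) gl_module"
  assumes M: "\<And>i. i \<in> J \<Longrightarrow> is_gl_module (M i)"
    and j: "j \<in> J" and v: "v \<in> carrier (M j)" "v \<noteq> \<zero>\<^bsub>M j\<^esub>"
  obtains e where "e \<in> carrier (gl_direct_sum J M)" "e \<oplus>\<^bsub>gl_direct_sum J M\<^esub> e \<noteq> e"
    "\<And>g c. invertible g \<Longrightarrow> act (M j) g v = c \<odot>\<^bsub>M j\<^esub> v \<Longrightarrow>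
       act (gl_direct_sum J M) g e = c \<odot>\<^bsub>gl_direct_sum J M\<^esub> e"
proof
  have mod: "Module.module (ring_of_type_algebra :: 'k ring) (M i)" if "i \<in> J" for i
    using M[OF that] by (simp add: is_gl_module_def)
  have zero: "\<zero>\<^bsub>M i\<^esub> \<in> carrier (M i)" if "i \<in> J" for i
    using abelian_monoid.zero_closed[OF abelian_group.axioms(1)[OF module.axioms(2)[OF mod[OF that]]]] .
  define e where "e = (\<lambda>i\<in>J. if i = j then v else \<zero>\<^bsub>M i\<^esub>)"
  have "finite {i \<in> J. e i \<noteq> \<zero>\<^bsub>M i\<^esub>}"
    by (rule finite_subset[of _ "{j}"]) (auto simp: e_def)
  then show "e \<in> carrier (gl_direct_sum J M)"
    using v zero by (auto simp: gl_direct_sum_def e_def)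
  show "e \<oplus>\<^bsub>gl_direct_sum J M\<^esub> e \<noteq> e"
  proof
    assume "e \<oplus>\<^bsub>gl_direct_sum J M\<^esub> e = e"
    then have "(\<lambda>i\<in>J. e i \<oplus>\<^bsub>M i\<^esub> e i) j = e j"
      by (simp add: gl_direct_sum_def)
    then have vv: "v \<oplus>\<^bsub>M j\<^esub> v = v"
      using j by (simp add: e_def)
    interpret N: abelian_group "M j"
      by (rule module.axioms(2)[OF mod[OF j]])
    from vv v show False
      by (simp add: N.add.r_cancel_one)
  qed
  fix g c
  assume g: "invertible g" "act (M j) g v = c \<odot>\<^bsub>M j\<^esub> v"
  have "act (M i) g (e i) = c \<odot>\<^bsub>M i\<^esub> e i" if "i \<in> J" for i
    using gl_module_act_zero[OF M[OF that] g(1)] module.smult_r_null[OF mod[OF that], of c] g(2) that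
    by (simp add: e_def)
  then show "act (gl_direct_sum J M) g e = c \<odot>\<^bsub>gl_direct_sum J M\<^esub> e"
    by (auto simp: gl_direct_sum_def intro: restrict_ext)
qed

theorem theorem3p3:
  fixes p :: nat
    and k :: "('n::{finite,linorder} \<Rightarrow> nat) \<Rightarrow> nat"
    and V :: "('n \<Rightarrow> nat) \<Rightarrow> ('k::field_char_0, 'v, 'n) gl_module"
  assumes "p \<ge> 1"
    and "\<And>lam. is_partition lam \<Longrightarrow> is_irreducible_with_highest_weight lam (V lam)"
    and "gl_isomorphic (proper_rel_free p :: ('k, ('n, 'k) free_alg set, 'n) gl_module)
           (sum_with_multiplicities k V)"
  shows "\<forall>lam. is_partition lam \<and> k lam \<noteq> 0 \<longrightarrow> first_part lam \<le> p - 1"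
proof (intro allI impI, elim conjE, rule ccontr)
  fix lam :: "'n \<Rightarrow> nat"
  assume lam: "is_partition lam" "k lam \<noteq> 0" and "\<not> first_part lam \<le> p - 1"
  with \<open>p \<ge> 1\<close> have large: "p \<le> first_part lam" by simp
  define P where "P = (proper_rel_free p :: ('k, ('n, 'k) free_alg set, 'n) gl_module)"
  define S where "S = sum_with_multiplicities k V"
  define J where "J = {(mu :: 'n \<Rightarrow> nat, i). is_partition mu \<and> i < k mu}"
  have S: "S = gl_direct_sum J (\<lambda>(mu, i). V mu)"
    by (simp add: S_def J_def sum_with_multiplicities_def)
  obtain v where v: "highest_weight_vector (V lam) lam v"
    using assms(2)[OF lam(1)] by (auto simp: is_irreducible_with_highest_weight_def)
  \<comment> \<open>Since \<open>k lam\<close> is nonzero, the copy of \<open>V lam\<close> numbered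
    0 occurs in the sum.\<close>
  have "(lam, 0) \<in> J"
    using lam by (simp add: J_def)
  moreover have "is_gl_module ((\<lambda>(mu, i). V mu) j)" if "j \<in> J" for j
    using that assms(2) by (auto simp: J_def is_irreducible_with_highest_weight_def)
  ultimately obtain e where e: "e \<in> carrier S" "e \<oplus>\<^bsub>S\<^esub> e \<noteq> e"
    "\<And>g c. invertible g \<Longrightarrow> act (V lam) g v = c \<odot>\<^bsub>V lam\<^esub> v \<Longrightarrow> act S g e = c \<odot>\<^bsub>S\<^esub> e"
    using direct_sum_summand_vector[of J "\<lambda>(mu, i). V mu" "(lam, 0)" v] v
    unfolding S highest_weight_vector_def by auto
  obtain \<Phi> where bij: "bij_betw \<Phi> (carrier P) (carrier S)"
    and \<Phi>_add: "\<And>a b. a \<in> carrier P \<Longrightarrow> b \<in> carrier P \<Longrightarrow> \<Phi> (a \<oplus>\<^bsub>P\<^esub> b) = \<Phi> a \<oplus>\<^bsub>S\<^esub> \<Phi> b"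
    and \<Phi>_smult: "\<And>c a. a \<in> carrier P \<Longrightarrow> \<Phi> (c \<odot>\<^bsub>P\<^esub> a) = c \<odot>\<^bsub>S\<^esub> \<Phi> a"
    and \<Phi>_act: "\<And>g a. invertible g \<Longrightarrow> a \<in> carrier P \<Longrightarrow> \<Phi> (act P g a) = act S g (\<Phi> a)"
    using assms(3) unfolding gl_isomorphic_def P_def S_def by auto
  have carrier_P: "carrier P = nat_surj p ` proper_polys"
    by (simp add: P_def proper_rel_free_def)
  have P_add: "nat_surj p f \<oplus>\<^bsub>P\<^esub> nat_surj p g = nat_surj p (f + g)" for f g
    using nat_surj_add[of p f g] by (simp add: P_def proper_rel_free_def)
  have P_smult: "c \<odot>\<^bsub>P\<^esub> nat_surj p f = nat_surj p (scal c * f)" for c f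
    using nat_surj_smult[of p c f] by (simp add: P_def proper_rel_free_def)
  have P_act: "act P (diag_matrix t) (nat_surj p f) = nat_surj p (torus t f)" if "\<And>i. t i \<noteq> 0" for t f
    using torus_nat_surj[OF that] by (simp add: P_def proper_rel_free_def rel_free_def)
  obtain f where f: "f \<in> proper_polys" and \<Phi>f: "\<Phi> (nat_surj p f) = e"
  proof -
    have "e \<in> \<Phi> ` nat_surj p ` proper_polys"
      using bij e(1) by (simp add: bij_betw_def carrier_P)
    then show thesis using that by blast
  qed
  have "torus (line_torus (Min UNIV) s) f - scal (s ^ first_part lam) * f \<in> comm_ideal (Suc p)"
    if "s \<noteq> 0" for s
  proof -
    define t where "t = line_torus (Min UNIV :: 'n) s"
    have t: "t i \<noteq> 0" for i
      using that by (simp add: t_def line_torus_def)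
    \<comment> \<open>All diagonal entries except the one at the first letter are 1, so only the
      first part of \<open>lam\<close> contributes to the weight.\<close>
    have "(\<Prod>i\<in>UNIV. t i ^ lam i) = (\<Prod>i\<in>UNIV. if i = Min UNIV then s ^ lam i else 1)"
      by (rule prod.cong) (auto simp: t_def line_torus_def)
    then have "(\<Prod>i\<in>UNIV. t i ^ lam i) = s ^ first_part lam"
      by (simp add: first_part_def)
    then have "act (V lam) (diag_matrix t) v = s ^ first_part lam \<odot>\<^bsub>V lam\<^esub> v"
      using v t by (auto simp: highest_weight_vector_def)
    then have "act S (diag_matrix t) e = s ^ first_part lam \<odot>\<^bsub>S\<^esub> e"
      by (rule e(3)[OF invertible_diag_matrix[OF t]])
    then have "\<Phi> (nat_surj p (torus t f)) = \<Phi> (nat_surj p (scal (s ^ first_part lam) * f))"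
      using f \<Phi>_act[OF invertible_diag_matrix[OF t], of "nat_surj p f"] \<Phi>_smult[of "nat_surj p f"]
      by (simp add: carrier_P P_act[OF t] P_smult \<Phi>f)
    \<comment> \<open>Injectivity of \<open>\<Phi>\<close> is known only on classes of proper
      polynomials, so both representatives must be proper.\<close>
    moreover have "scal (s ^ first_part lam) * f \<in> proper_polys"
      by (rule proper_polys_mult[OF scal_in_proper_polys f])
    ultimately have "nat_surj p (torus t f) = nat_surj p (scal (s ^ first_part lam) * f)"
      using bij f torus_proper_polys[OF f, of t] by (auto simp: bij_betw_def inj_on_def carrier_P)
    then show ?thesis
      using nat_surj_self[of "torus t f" p] by (simp add: t_def nat_surj_eq)
  qed
  then have "f \<in> comm_ideal (Suc p)"
    using proper_weight_vector_in_comm_ideal[OF f _ large] by blast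
  \<comment> \<open>The class of \<open>f\<close> is zero and hence equals its own double, which
    \<open>\<Phi>\<close> carries over to \<open>e\<close>.\<close>
  then have "nat_surj p f \<oplus>\<^bsub>P\<^esub> nat_surj p f = nat_surj p f"
    unfolding P_add by (simp add: nat_surj_zero_class comm_ideal_add)
  then have "e \<oplus>\<^bsub>S\<^esub> e = e"
    using \<Phi>_add[of "nat_surj p f" "nat_surj p f"] f by (simp add: carrier_P \<Phi>f)
  with e(2) show False by contradiction
qed

end
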